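(* Let $S$ be a right LCM semigroup with identity. Suppose that (1) $S$ is directed with respect to $\leq$, or (2) incomparable elements of $S$ have disjoint principal right ideals. Then every foundation set $F$ for $S$ has an accurate refinement $F_a$ (that is, an accurate foundation set $F_a$ such that every $f_a\in F_a$ lies in $fS$ for some $f\in F$) satisfying $F_a\subset F$. In particular, $S$ has property (AR).
   Context: All semigroups are countable, discrete and left cancellative. A semigroup is right LCM if the intersection of two principal right ideals is either empty or again a principal right ideal. For $s,t\in S$ write $s\leq t$ if $t\in sS$. Elements $s,t$ are comparable if $s\leq t$ or $t\leq s$, and incomparable otherwise. $S$ is directed with respect to $\leq$ if any two elements have a common upper bound, i.e. $sS\cap tS\neq\emptyset$ for all $s,t\in S$. A finite subset $F\subset S$ is a foundation set for $S$ if for every $s\in S$ there is $t\in F$ with $sS\cap tS\neq\emptyset$. A foundation set $F$ is accurate if $sS\cap tS=\emptyset$ for all distinct $s,t\in F$. $S$ has the accurate refinement property, property (AR), if every foundation set $F$ has an accurate refinement, i.e. there is an accurate foundation set $F_a$ such that every $f_a\in F_a$ lies in $fS$ for some $f\in F$. *)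

theory Defs
  imports "HOL-Algebra.Coset" "HOL-Library.Countable_Set"
begin

(* Semigroups are carried by HOL-Algebra monoid records; apart from the hypothesis monoid S in
   the theorem itself, only the carrier and the multiplication are used, never the unit field. *)

locale left_cancellative_semigroup =
  fixes S :: "('a, 'b) monoid_scheme" (structure)
  assumes mult_closed: "\<lbrakk>x \<in> carrier S; y \<in> carrier S\<rbrakk> \<Longrightarrow> x \<otimes> y \<in> carrier S"
    and mult_assoc: "\<lbrakk>x \<in> carrier S; y \<in> carrier S; z \<in> carrier S\<rbrakk>
      \<Longrightarrow> (x \<otimes> y) \<otimes> z = x \<otimes> (y \<otimes> z)"
    and left_cancel: "\<lbrakk>x \<in> carrier S; y \<in> carrier S; z \<in> carrier S; x \<otimes> y = x \<otimes> z\<rbrakk>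
      \<Longrightarrow> y = z"
    and countable_carrier: "countable (carrier S)"

definition principal_right_ideal :: "('a, 'b) monoid_scheme \<Rightarrow> 'a \<Rightarrow> 'a set" where
  "principal_right_ideal S s = s <#\<^bsub>S\<^esub> carrier S"

locale right_LCM_semigroup = left_cancellative_semigroup S
  for S :: "('a, 'b) monoid_scheme" (structure) +
  assumes right_LCM: "\<lbrakk>s \<in> carrier S; t \<in> carrier S\<rbrakk> \<Longrightarrow>
    principal_right_ideal S s \<inter> principal_right_ideal S t = {} \<or>
    (\<exists>r\<in>carrier S. principal_right_ideal S s \<inter> principal_right_ideal S t
       = principal_right_ideal S r)"

definition sg_le :: "('a, 'b) monoid_scheme \<Rightarrow> 'a \<Rightarrow> 'a \<Rightarrow> bool" where
  "sg_le S s t \<longleftrightarrow> t \<in> principal_right_ideal S s"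

definition comparable :: "('a, 'b) monoid_scheme \<Rightarrow> 'a \<Rightarrow> 'a \<Rightarrow> bool" where
  "comparable S s t \<longleftrightarrow> sg_le S s t \<or> sg_le S t s"

definition directed :: "('a, 'b) monoid_scheme \<Rightarrow> bool" where
  "directed S \<longleftrightarrow>
    (\<forall>s\<in>carrier S. \<forall>t\<in>carrier S. \<exists>u\<in>carrier S. sg_le S s u \<and> sg_le S t u)"

definition incomparable_disjoint :: "('a, 'b) monoid_scheme \<Rightarrow> bool" where
  "incomparable_disjoint S \<longleftrightarrow>
    (\<forall>s\<in>carrier S. \<forall>t\<in>carrier S. \<not> comparable S s t \<longrightarrow>
       principal_right_ideal S s \<inter> principal_right_ideal S t = {})"

definition foundation_set :: "('a, 'b) monoid_scheme \<Rightarrow> 'a set \<Rightarrow> bool" where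
  "foundation_set S F \<longleftrightarrow> finite F \<and> F \<subseteq> carrier S \<and>
    (\<forall>s\<in>carrier S. \<exists>t\<in>F. principal_right_ideal S s \<inter> principal_right_ideal S t \<noteq> {})"

definition accurate_foundation_set :: "('a, 'b) monoid_scheme \<Rightarrow> 'a set \<Rightarrow> bool" where
  "accurate_foundation_set S F \<longleftrightarrow> foundation_set S F \<and>
    (\<forall>s\<in>F. \<forall>t\<in>F. s \<noteq> t \<longrightarrow>
       principal_right_ideal S s \<inter> principal_right_ideal S t = {})"

definition accurate_refinement :: "('a, 'b) monoid_scheme \<Rightarrow> 'a set \<Rightarrow> 'a set \<Rightarrow> bool" where
  "accurate_refinement S F Fa \<longleftrightarrow> accurate_foundation_set S Fa \<and>
    (\<forall>fa\<in>Fa. \<exists>f\<in>F. fa \<in> principal_right_ideal S f)"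

definition property_AR :: "('a, 'b) monoid_scheme \<Rightarrow> bool" where
  "property_AR S \<longleftrightarrow> (\<forall>F. foundation_set S F \<longrightarrow> (\<exists>Fa. accurate_refinement S F Fa))"

end

theory Submission
  imports Defs
begin

text \<open>
  A foundation subset of \<open>F\<close> that is minimal under inclusion is accurate: if two distinct elements
  of a foundation set have intersecting principal right ideals, then one of them is redundant,
  because either any single element is already a foundation set (directed case), or the two
  elements are comparable and the larger one, having the smaller ideal, can be dropped.
\<close>

lemma (in left_cancellative_semigroup) principal_right_ideal_mono:
  assumes "s \<in> carrier S" and "sg_le S s t"
  shows "principal_right_ideal S t \<subseteq> principal_right_ideal S s"
proof
  fix y
  assume "y \<in> principal_right_ideal S t"
  then obtain b where "b \<in> carrier S" "y = t \<otimes> b"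
    by (auto simp: principal_right_ideal_def l_coset_def)
  moreover obtain a where "a \<in> carrier S" "t = s \<otimes> a"
    using assms(2) by (auto simp: sg_le_def principal_right_ideal_def l_coset_def)
  ultimately have "a \<otimes> b \<in> carrier S" "y = s \<otimes> (a \<otimes> b)"
    using assms(1) by (auto simp: mult_closed mult_assoc)
  then show "y \<in> principal_right_ideal S s"
    by (auto simp: principal_right_ideal_def l_coset_def)
qed

lemma directed_ideals_meet:
  assumes "directed S" and "s \<in> carrier S" and "t \<in> carrier S"
  shows "principal_right_ideal S s \<inter> principal_right_ideal S t \<noteq> {}"
  using assms unfolding directed_def sg_le_def by blast

text \<open>An ideal that meets \<open>t\<close> only needs a witness in \<open>F - {t}\<close>:
  since the ideal of \<open>t\<close> lies inside that of \<open>s\<close>, the element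
  \<open>s\<close> serves, and \<open>s \<noteq> t\<close> keeps it in the set.\<close>

lemma foundation_set_remove_larger:
  assumes "left_cancellative_semigroup S"
    and F: "foundation_set S F" and "s \<in> F" and "s \<noteq> t" and "sg_le S s t"
  shows "foundation_set S (F - {t})"
proof -
  have "s \<in> carrier S"
    using F \<open>s \<in> F\<close> by (auto simp: foundation_set_def)
  then have "principal_right_ideal S t \<subseteq> principal_right_ideal S s"
    using assms by (intro left_cancellative_semigroup.principal_right_ideal_mono)
  then show ?thesis
    using F \<open>s \<in> F\<close> \<open>s \<noteq> t\<close> unfolding foundation_set_def by blast
qed

lemma foundation_set_remove_one:
  assumes S: "left_cancellative_semigroup S" and "directed S \<or> incomparable_disjoint S"
    and F: "foundation_set S F" and st: "s \<in> F" "t \<in> F" "s \<noteq> t"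
    and meet: "principal_right_ideal S s \<inter> principal_right_ideal S t \<noteq> {}"
  shows "\<exists>x\<in>F. foundation_set S (F - {x})"
  using assms(2)
proof
  assume "directed S"
  \<comment> \<open>Every principal right ideal meets that of \<open>s\<close>, which survives the
    removal.\<close>
  then have "foundation_set S (F - {t})"
    using F st directed_ideals_meet[of S] unfolding foundation_set_def by blast
  then show ?thesis
    using st by blast
next
  assume "incomparable_disjoint S"
  \<comment> \<open>By \<open>meet\<close> the ideals are not disjoint, so \<open>s\<close> and
    \<open>t\<close> are comparable. Which of them is redundant depends on the direction, hence the
    existential in the conclusion.\<close>
  then have "sg_le S s t \<or> sg_le S t s"
    using F st meet unfolding incomparable_disjoint_def comparable_def foundation_set_def by blast
  then show ?thesis
    using foundation_set_remove_larger[OF S F] st by metis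
qed

text \<open>Redundant elements are discarded one at a time; finiteness of \<open>F\<close> makes
  this stop, and it can only stop at an accurate set.\<close>

lemma ex_accurate_foundation_subset:
  assumes S: "left_cancellative_semigroup S" "directed S \<or> incomparable_disjoint S"
    and F: "foundation_set S F"
  shows "\<exists>Fa\<subseteq>F. accurate_foundation_set S Fa"
proof -
  have "finite F"
    using F by (simp add: foundation_set_def)
  then show ?thesis
    using F
  proof (induction F rule: finite_psubset_induct)
    case (psubset F)
    show ?case
    proof (cases "accurate_foundation_set S F")
      case False
      \<comment> \<open>As \<open>F\<close> is a foundation set, failure of accuracy yields two
        distinct elements with meeting ideals.\<close>
      then obtain x where "x \<in> F" "foundation_set S (F - {x})"
        using foundation_set_remove_one[OF S psubset.prems] psubset.prems
        unfolding accurate_foundation_set_def by blast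
      then show ?thesis
        using psubset.IH[of "F - {x}"] by blast
    qed blast
  qed
qed

text \<open>The identity enters here, through \<open>x = x \<otimes> \<one>\<close>.\<close>

lemma (in monoid) mem_principal_right_ideal:
  "x \<in> carrier G \<Longrightarrow> x \<in> principal_right_ideal G x"
  unfolding principal_right_ideal_def l_coset_def by (auto intro!: bexI[of _ "\<one>"])

theorem proposition2p6:
  fixes S :: "('a, 'b) monoid_scheme"
  assumes "right_LCM_semigroup S"
    and "monoid S"
    and "directed S \<or> incomparable_disjoint S"
  shows "(\<forall>F. foundation_set S F \<longrightarrow> (\<exists>Fa. accurate_refinement S F Fa \<and> Fa \<subseteq> F))
    \<and> property_AR S"
proof -
  have S: "left_cancellative_semigroup S"
    using assms(1) by (simp add: right_LCM_semigroup_def)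
  have "\<exists>Fa. accurate_refinement S F Fa \<and> Fa \<subseteq> F" if F: "foundation_set S F" for F
  proof -
    obtain Fa where Fa: "Fa \<subseteq> F" "accurate_foundation_set S Fa"
      using ex_accurate_foundation_subset[OF S assms(3) F] by blast
    moreover have "F \<subseteq> carrier S"
      using F by (simp add: foundation_set_def)
    \<comment> \<open>Each element of \<open>Fa\<close> refines itself, being a member of
      \<open>F\<close> that lies in its own ideal.\<close>
    ultimately have "accurate_refinement S F Fa"
      unfolding accurate_refinement_def using monoid.mem_principal_right_ideal[OF assms(2)] by blast
    then show ?thesis
      using Fa(1) by blast
  qed
  then show ?thesis
    unfolding property_AR_def by blast
qed

end
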